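(* Let $M$ be a residually finite monoid and let $A$ be a finite set. Let $\mathrm{CA}(M,A)$ denote the monoid, under composition of maps, of all cellular automata $\tau \colon A^M \to A^M$ over the monoid $M$ and the alphabet $A$. Then every finitely generated subsemigroup of $\mathrm{CA}(M,A)$ is Hopfian.
   Context: A semigroup is a set with an associative binary operation; a semigroup morphism is a map preserving products. A semigroup $S$ is Hopfian if every surjective semigroup endomorphism of $S$ is injective. Finitely generated subsemigroup means finitely generated as a semigroup. A monoid is a semigroup admitting an identity element; a monoid morphism is a semigroup morphism sending the identity element to the identity element. A monoid $N$ is residually finite if for any two distinct elements $n_1, n_2 \in N$ there exist a finite monoid $F$ and a monoid morphism $\rho \colon N \to F$ such that $\rho(n_1) \neq \rho(n_2)$. For a monoid $M$ and a finite set $A$ (the alphabet), $A^M$ denotes the set of all maps $x \colon M \to A$ (configurations). It is equipped with the prodiscrete topology, i.e. the product topology on $A^M = \prod_{m \in M} A$ where each factor $A$ carries the discrete topology, and with the $M$-shift, i.e. the action of $M$ given by $(m,x) \mapsto mx$, where $(mx)(m') = x(m'm)$ for all $x \in A^M$ and $m, m' \in M$. A cellular automaton over $M$ and $A$ is a map $\tau \colon A^M \to A^M$ that is continuous for the prodiscrete topology and satisfies $\tau(mx) = m\tau(x)$ for all $m \in M$ and $x \in A^M$. *)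

theory Defs
  imports "HOL-Analysis.Function_Topology" "HOL-Algebra.Group"
begin

text \<open>
  Semigroups and monoids are carried by the record type of \<^theory>\<open>HOL-Algebra.Group\<close>. For
  semigroups the \<^const>\<open>one\<close> field is ignored; \<^const>\<open>hom\<close> only asks that products be preserved.
\<close>

definition semigroup_struct :: "('a, 'b) monoid_scheme \<Rightarrow> bool" where
  "semigroup_struct S \<longleftrightarrow>
     (\<forall>x\<in>carrier S. \<forall>y\<in>carrier S. x \<otimes>\<^bsub>S\<^esub> y \<in> carrier S) \<and>
     (\<forall>x\<in>carrier S. \<forall>y\<in>carrier S. \<forall>z\<in>carrier S.
        (x \<otimes>\<^bsub>S\<^esub> y) \<otimes>\<^bsub>S\<^esub> z = x \<otimes>\<^bsub>S\<^esub> (y \<otimes>\<^bsub>S\<^esub> z))"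

definition Hopfian :: "('a, 'b) monoid_scheme \<Rightarrow> bool" where
  "Hopfian S \<longleftrightarrow>
     semigroup_struct S \<and>
     (\<forall>f\<in>epi S S. inj_on f (carrier S))"

definition subsemigroup :: "'a set \<Rightarrow> ('a, 'b) monoid_scheme \<Rightarrow> bool" where
  "subsemigroup T S \<longleftrightarrow> T \<subseteq> carrier S \<and> (\<forall>x\<in>T. \<forall>y\<in>T. x \<otimes>\<^bsub>S\<^esub> y \<in> T)"

inductive_set semigroup_generate :: "('a, 'b) monoid_scheme \<Rightarrow> 'a set \<Rightarrow> 'a set"
  for S and B where
    incl: "b \<in> B \<Longrightarrow> b \<in> semigroup_generate S B"
  | mult: "x \<in> semigroup_generate S B \<Longrightarrow> y \<in> semigroup_generate S B \<Longrightarrow>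
           x \<otimes>\<^bsub>S\<^esub> y \<in> semigroup_generate S B"

definition fin_gen_subsemigroup :: "'a set \<Rightarrow> ('a, 'b) monoid_scheme \<Rightarrow> bool" where
  "fin_gen_subsemigroup T S \<longleftrightarrow>
     subsemigroup T S \<and> (\<exists>B. finite B \<and> B \<subseteq> T \<and> semigroup_generate S B = T)"

definition monoid_hom :: "('a, 'b) monoid_scheme \<Rightarrow> ('c, 'd) monoid_scheme \<Rightarrow> ('a \<Rightarrow> 'c) set" where
  "monoid_hom G H = {f \<in> hom G H. f \<one>\<^bsub>G\<^esub> = \<one>\<^bsub>H\<^esub>}"

text \<open>
  HOL cannot quantify over the type carrying the finite monoid. Every finite monoid is isomorphic
  to one whose elements are natural numbers, so nothing is lost by fixing that type; see
  \<open>residually_finiteI\<close> below.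
\<close>

definition residually_finite :: "('a, 'b) monoid_scheme \<Rightarrow> bool" where
  "residually_finite N \<longleftrightarrow>
     (\<forall>n\<^sub>1\<in>carrier N. \<forall>n\<^sub>2\<in>carrier N. n\<^sub>1 \<noteq> n\<^sub>2 \<longrightarrow>
        (\<exists>F :: nat monoid. monoid F \<and> finite (carrier F) \<and>
           (\<exists>\<rho>\<in>monoid_hom N F. \<rho> n\<^sub>1 \<noteq> \<rho> n\<^sub>2)))"

lemma residually_finiteI:
  fixes N :: "('a, 'b) monoid_scheme"
  assumes "\<And>n\<^sub>1 n\<^sub>2. n\<^sub>1 \<in> carrier N \<Longrightarrow> n\<^sub>2 \<in> carrier N \<Longrightarrow> n\<^sub>1 \<noteq> n\<^sub>2 \<Longrightarrow>
    \<exists>F :: ('c, 'd) monoid_scheme. monoid F \<and> finite (carrier F) \<and>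
      (\<exists>\<rho>\<in>monoid_hom N F. \<rho> n\<^sub>1 \<noteq> \<rho> n\<^sub>2)"
  shows "residually_finite N"
  unfolding residually_finite_def
proof (intro ballI impI)
  fix n1 n2 assume n: "n1 \<in> carrier N" "n2 \<in> carrier N" "n1 \<noteq> n2"
  obtain F :: "('c, 'd) monoid_scheme" and \<rho> where F: "monoid F" "finite (carrier F)"
    and \<rho>: "\<rho> \<in> hom N F" "\<rho> \<one>\<^bsub>N\<^esub> = \<one>\<^bsub>F\<^esub>" "\<rho> n1 \<noteq> \<rho> n2"
    using assms[OF n] unfolding monoid_hom_def by auto
  interpret monoid F by (rule F(1))
  obtain e :: "'c \<Rightarrow> nat" where e: "inj_on e (carrier F)"
    using finite_imp_inj_to_nat_seg[OF F(2)] by auto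
  define d where "d = inv_into (carrier F) e"
  have d: "d (e x) = x" if "x \<in> carrier F" for x
    using e that by (simp add: d_def)
  define F' :: "nat monoid" where
    "F' = \<lparr>carrier = e ` carrier F, mult = (\<lambda>x y. e (d x \<otimes>\<^bsub>F\<^esub> d y)), one = e \<one>\<^bsub>F\<^esub>\<rparr>"
  have "monoid F'"
    by (rule monoidI) (auto simp: F'_def d m_assoc)
  moreover have "finite (carrier F')"
    using F(2) by (simp add: F'_def)
  moreover have "e \<circ> \<rho> \<in> monoid_hom N F'"
    using \<rho> by (auto simp: monoid_hom_def hom_def F'_def d Pi_iff)
  moreover have "(e \<circ> \<rho>) n1 \<noteq> (e \<circ> \<rho>) n2"
    using \<rho> n e by (auto simp: hom_def Pi_iff dest: inj_onD)
  ultimately show "\<exists>F :: nat monoid. monoid F \<and> finite (carrier F) \<and>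
      (\<exists>\<rho>\<in>monoid_hom N F. \<rho> n1 \<noteq> \<rho> n2)"
    by blast
qed

text \<open>
  Configurations and cellular automata are functions extended by \<^const>\<open>undefined\<close> outside their
  domain, so that equality of HOL functions is equality of maps.
\<close>

definition configurations :: "('m, 'b) monoid_scheme \<Rightarrow> 'a set \<Rightarrow> ('m \<Rightarrow> 'a) set" where
  "configurations M A = carrier M \<rightarrow>\<^sub>E A"

definition prodiscrete :: "('m, 'b) monoid_scheme \<Rightarrow> 'a set \<Rightarrow> ('m \<Rightarrow> 'a) topology" where
  "prodiscrete M A = product_topology (\<lambda>_. discrete_topology A) (carrier M)"

lemma topspace_prodiscrete: "topspace (prodiscrete M A) = configurations M A"
  by (simp add: prodiscrete_def configurations_def)

definition shift :: "('m, 'b) monoid_scheme \<Rightarrow> 'm \<Rightarrow> ('m \<Rightarrow> 'a) \<Rightarrow> 'm \<Rightarrow> 'a" where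
  "shift M m x = (\<lambda>m'\<in>carrier M. x (m' \<otimes>\<^bsub>M\<^esub> m))"

definition cellular_automata ::
    "('m, 'b) monoid_scheme \<Rightarrow> 'a set \<Rightarrow> (('m \<Rightarrow> 'a) \<Rightarrow> 'm \<Rightarrow> 'a) set" where
  "cellular_automata M A =
     {\<tau> \<in> configurations M A \<rightarrow>\<^sub>E configurations M A.
        continuous_map (prodiscrete M A) (prodiscrete M A) \<tau> \<and>
        (\<forall>m\<in>carrier M. \<forall>x\<in>configurations M A. \<tau> (shift M m x) = shift M m (\<tau> x))}"

definition CA :: "('m, 'b) monoid_scheme \<Rightarrow> 'a set \<Rightarrow> (('m \<Rightarrow> 'a) \<Rightarrow> 'm \<Rightarrow> 'a) monoid" where
  "CA M A = \<lparr>carrier = cellular_automata M A,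
             mult = (\<lambda>\<sigma> \<tau>. compose (configurations M A) \<sigma> \<tau>),
             one = (\<lambda>x\<in>configurations M A. x)\<rparr>"

lemma (in monoid) shift_in_configurations:
  assumes "m \<in> carrier G" and "x \<in> configurations G A"
  shows "shift G m x \<in> configurations G A"
  using assms by (auto simp: shift_def configurations_def)

lemma (in monoid) monoid_CA: "monoid (CA G A)"
proof (rule monoidI)
  let ?C = "configurations G A"
  fix \<sigma> \<tau> assume "\<sigma> \<in> carrier (CA G A)" "\<tau> \<in> carrier (CA G A)"
  then have s: "\<sigma> \<in> cellular_automata G A" and t: "\<tau> \<in> cellular_automata G A"
    by (simp_all add: CA_def)
  have "continuous_map (prodiscrete G A) (prodiscrete G A) (\<sigma> \<circ> \<tau>)"
    using s t by (auto simp: cellular_automata_def intro: continuous_map_compose)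
  then have "continuous_map (prodiscrete G A) (prodiscrete G A) (compose ?C \<sigma> \<tau>)"
    by (rule continuous_map_eq) (simp add: topspace_prodiscrete compose_def)
  then show "\<sigma> \<otimes>\<^bsub>CA G A\<^esub> \<tau> \<in> carrier (CA G A)"
    using s t by (auto simp: CA_def cellular_automata_def compose_def shift_in_configurations PiE_iff)
next
  have "continuous_map (prodiscrete G A) (prodiscrete G A) (\<lambda>x\<in>configurations G A. x)"
    by (rule continuous_map_eq[OF continuous_map_id]) (simp add: topspace_prodiscrete)
  then show "\<one>\<^bsub>CA G A\<^esub> \<in> carrier (CA G A)"
    by (auto simp: CA_def cellular_automata_def shift_in_configurations)
qed (auto simp: CA_def cellular_automata_def PiE_iff compose_def fun_eq_iff extensional_def)

end

theory Submission
  imports Defs "HOL-Analysis.Abstract_Topological_Spaces"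
begin

text \<open>
  The theorem combines Malcev's argument, that a finitely generated residually finite semigroup is
  Hopfian, with the residual finiteness of \<^term>\<open>CA M A\<close>.

  For the latter, call a configuration periodic if its orbit under the shift is finite. If \<open>x\<close> is
  periodic, then the configurations \<open>y\<close> whose orbit map \<open>m \<mapsto> my\<close> identifies all the elements of
  \<open>M\<close> that the orbit map of \<open>x\<close> identifies form a finite set, since such a \<open>y\<close> is determined by a
  map from the orbit of \<open>x\<close> to \<open>A\<close>. A cellular automaton commutes with the shift and hence
  preserves this set, so restriction to it is a morphism from \<^term>\<open>CA M A\<close> to a finite semigroup
  of maps. These morphisms separate cellular automata (\<open>CA_residually_finite\<close>): two cellular
  automata that agree on all periodic configurations are equal by continuity, because residual
  finiteness of \<open>M\<close> makes periodic configurations dense (\<open>periodic_dense\<close>).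

  For the former (\<open>Hopfian_if_residually_finite\<close>), let \<open>f\<close> be a surjective endomorphism with
  \<open>f a = f b\<close> and let \<open>\<phi>\<close> be a morphism to a finite semigroup. A finitely generated semigroup has
  only finitely many morphisms to a finite one, so \<open>\<phi> \<circ> f\<^sup>i = \<phi> \<circ> f\<^sup>j\<close> for some \<open>i < j\<close>; cancelling
  the surjection \<open>f\<^sup>i\<close> gives \<open>\<phi> = \<phi> \<circ> f\<^sup>j\<^sup>-\<^sup>i\<close>, whence \<open>\<phi> a = \<phi> b\<close>. So no morphism to a finite
  semigroup separates \<open>a\<close> and \<open>b\<close>, and they are equal.
\<close>

section \<open>Finitely generated residually finite semigroups\<close>

lemma semigroup_generate_carrier_update [simp]:
  "semigroup_generate (S\<lparr>carrier := T\<rparr>) B = semigroup_generate S B"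
proof (intro subset_antisym subsetI)
  fix x assume "x \<in> semigroup_generate (S\<lparr>carrier := T\<rparr>) B"
  then show "x \<in> semigroup_generate S B"
    by induction (auto intro: semigroup_generate.intros)
next
  fix x assume "x \<in> semigroup_generate S B"
  then show "x \<in> semigroup_generate (S\<lparr>carrier := T\<rparr>) B"
  proof induction
    case (mult x y)
    then show ?case
      using semigroup_generate.mult[of x "S\<lparr>carrier := T\<rparr>" B y] by simp
  qed (auto intro: semigroup_generate.intros)
qed

lemma hom_eq_if_eq_on_generators:
  assumes "\<phi> \<in> hom S F" and "\<psi> \<in> hom S F"
    and gen: "semigroup_generate S B = carrier S"
    and eq: "\<And>b. b \<in> B \<Longrightarrow> \<phi> b = \<psi> b"
    and "x \<in> carrier S"
  shows "\<phi> x = \<psi> x"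
proof -
  from \<open>x \<in> carrier S\<close> have "x \<in> semigroup_generate S B"
    by (simp add: gen)
  then show ?thesis
    by induction (use assms(1,2) in \<open>auto simp: eq gen hom_def\<close>)
qed

text \<open>
  Morphisms are compared on the carrier only, as their values elsewhere are arbitrary.
\<close>

lemma finite_homs_on_carrier:
  assumes "finite B" and gen: "semigroup_generate S B = carrier S" and "finite (carrier F)"
  shows "finite ((\<lambda>\<phi>. restrict \<phi> (carrier S)) ` hom S F)"
proof (rule inj_on_finite)
  have B: "B \<subseteq> carrier S"
    using gen by (auto intro: semigroup_generate.incl)
  show "inj_on (\<lambda>\<phi>. restrict \<phi> B) ((\<lambda>\<phi>. restrict \<phi> (carrier S)) ` hom S F)"
  proof (rule inj_onI, elim imageE, clarify)
    fix \<phi> \<psi> assume hom: "\<phi> \<in> hom S F" "\<psi> \<in> hom S F"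
      and eq: "restrict (restrict \<phi> (carrier S)) B = restrict (restrict \<psi> (carrier S)) B"
    have "\<phi> b = \<psi> b" if "b \<in> B" for b
      using fun_cong[OF eq, of b] that B by auto
    then show "restrict \<phi> (carrier S) = restrict \<psi> (carrier S)"
      by (rule restrict_ext[OF hom_eq_if_eq_on_generators[OF hom gen]])
  qed
  show "(\<lambda>\<phi>. restrict \<phi> B) ` (\<lambda>\<phi>. restrict \<phi> (carrier S)) ` hom S F \<subseteq> B \<rightarrow>\<^sub>E carrier F"
    using B by (auto simp: hom_def)
  show "finite (B \<rightarrow>\<^sub>E carrier F)"
    using assms by (intro finite_PiE)
qed

lemma funpow_epi:
  assumes "f \<in> epi S S"
  shows "f ^^ n \<in> epi S S"
proof (induction n)
  case 0
  show ?case by (auto simp: epi_def hom_def)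
next
  case (Suc n)
  then have "f ^^ n \<in> hom S S" "(f ^^ n) ` carrier S = carrier S"
    by (simp_all add: epi_def)
  moreover have f: "f \<in> hom S S" "f ` carrier S = carrier S"
    using assms by (simp_all add: epi_def)
  ultimately have "f \<circ> f ^^ n \<in> hom S S"
    by (blast intro: hom_compose)
  moreover have "(f \<circ> f ^^ n) ` carrier S = carrier S"
    using f(2) \<open>(f ^^ n) ` carrier S = carrier S\<close> by (metis image_comp)
  ultimately show ?case
    by (simp only: epi_def funpow.simps mem_Collect_eq simp_thms)
qed

text \<open>
  Malcev's argument. Since a surjective endomorphism \<open>f\<close> can be cancelled on the right, the
  coincidence of two of the morphisms \<open>\<phi> \<circ> f\<^sup>n\<close> says that \<open>\<phi>\<close> factors through \<open>f\<close>.
\<close>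

lemma hom_to_finite_eq_if_epi_eq:
  assumes "finite B" and gen: "semigroup_generate S B = carrier S"
    and "finite (carrier F)" and \<phi>: "\<phi> \<in> hom S F"
    and f: "f \<in> epi S S" and a: "a \<in> carrier S" and b: "b \<in> carrier S" and "f a = f b"
  shows "\<phi> a = \<phi> b"
proof -
  have hom: "\<phi> \<circ> f ^^ n \<in> hom S F" for n
    using funpow_epi[OF f, of n] \<phi> by (auto simp: epi_def intro: hom_compose)
  let ?r = "\<lambda>n. restrict (\<phi> \<circ> f ^^ n) (carrier S)"
  have "finite (range ?r)"
    by (rule finite_subset[OF _ finite_homs_on_carrier[OF assms(1-3)]]) (use hom in blast)
  then have "\<not> inj ?r"
    using finite_imageD infinite_UNIV_nat by blast
  then obtain i j where "i < j" and eq: "?r i = ?r j"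
    unfolding inj_def by (metis linorder_neqE_nat)
  define k where "k = j - i - 1"
  have j: "j = Suc k + i"
    using \<open>i < j\<close> by (simp add: k_def)
  have "\<phi> s = \<phi> ((f ^^ Suc k) s)" if "s \<in> carrier S" for s
  proof -
    from that obtain t where t: "t \<in> carrier S" "s = (f ^^ i) t"
      using funpow_epi[OF f, of i] by (auto simp: epi_def)
    then show ?thesis
      using fun_cong[OF eq, of t] by (simp add: j funpow_add)
  qed
  then show ?thesis
    using a b \<open>f a = f b\<close> by (simp add: funpow_Suc_right del: funpow.simps)
qed

lemma Hopfian_if_residually_finite:
  fixes S :: "('a, 'b) monoid_scheme"
  assumes "semigroup_struct S"
    and "finite B" and "semigroup_generate S B = carrier S"
    and sep: "\<And>a b. a \<in> carrier S \<Longrightarrow> b \<in> carrier S \<Longrightarrow> a \<noteq> b \<Longrightarrow>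
      \<exists>F :: ('c, 'd) monoid_scheme. finite (carrier F) \<and> (\<exists>\<phi>\<in>hom S F. \<phi> a \<noteq> \<phi> b)"
  shows "Hopfian S"
  unfolding Hopfian_def
proof (intro conjI ballI inj_onI)
  fix f a b
  assume f: "f \<in> epi S S" and ab: "a \<in> carrier S" "b \<in> carrier S" "f a = f b"
  show "a = b"
  proof (rule ccontr)
    assume "a \<noteq> b"
    then obtain F :: "('c, 'd) monoid_scheme" and \<phi>
      where "finite (carrier F)" "\<phi> \<in> hom S F" "\<phi> a \<noteq> \<phi> b"
      using sep ab by blast
    then show False
      using hom_to_finite_eq_if_epi_eq[OF assms(2,3) _ _ f ab] by blast
  qed
qed (rule assms(1))

section \<open>Density of periodic configurations\<close>

definition periodic :: "('m, 'b) monoid_scheme \<Rightarrow> 'a set \<Rightarrow> ('m \<Rightarrow> 'a) set" where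
  "periodic M A = {x \<in> configurations M A. finite ((\<lambda>m. shift M m x) ` carrier M)}"

text \<open>
  The fibres of \<open>\<Phi>\<close> below are the classes of a left congruence of finite index that separates
  \<open>\<Omega>\<close>. It is the intersection of the kernels of finitely many morphisms, one for each pair
  of distinct elements of \<open>\<Omega>\<close>; \<open>\<Phi>\<close> is the morphism to the product of their targets.
\<close>

lemma residually_finite_separates_finite:
  fixes M :: "('m, 'b) monoid_scheme"
  assumes "residually_finite M" and "finite \<Omega>" and "\<Omega> \<subseteq> carrier M"
  obtains \<Phi> :: "'m \<Rightarrow> 'm \<times> 'm \<Rightarrow> nat"
  where "finite (\<Phi> ` carrier M)" and "inj_on \<Phi> \<Omega>"
    and "\<And>m\<^sub>1 m\<^sub>2 m. m\<^sub>1 \<in> carrier M \<Longrightarrow> m\<^sub>2 \<in> carrier M \<Longrightarrow> m \<in> carrier M \<Longrightarrow>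
      \<Phi> m\<^sub>1 = \<Phi> m\<^sub>2 \<Longrightarrow> \<Phi> (m \<otimes>\<^bsub>M\<^esub> m\<^sub>1) = \<Phi> (m \<otimes>\<^bsub>M\<^esub> m\<^sub>2)"
proof -
  let ?P = "\<Omega> \<times> \<Omega> - Id"
  have "\<forall>p\<in>?P. \<exists>F :: nat monoid. \<exists>\<rho>. finite (carrier F) \<and> \<rho> \<in> hom M F \<and> \<rho> (fst p) \<noteq> \<rho> (snd p)"
  proof
    fix p assume "p \<in> ?P"
    then have "fst p \<in> carrier M" "snd p \<in> carrier M" "fst p \<noteq> snd p"
      using assms(3) by auto
    then show "\<exists>F :: nat monoid. \<exists>\<rho>. finite (carrier F) \<and> \<rho> \<in> hom M F \<and> \<rho> (fst p) \<noteq> \<rho> (snd p)"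
      using assms(1) unfolding residually_finite_def monoid_hom_def by blast
  qed
  then obtain F :: "'m \<times> 'm \<Rightarrow> nat monoid" and \<rho>
    where fin: "\<And>p. p \<in> ?P \<Longrightarrow> finite (carrier (F p))"
      and hom: "\<And>p. p \<in> ?P \<Longrightarrow> \<rho> p \<in> hom M (F p)"
      and sep: "\<And>p. p \<in> ?P \<Longrightarrow> \<rho> p (fst p) \<noteq> \<rho> p (snd p)"
    by metis
  define \<Phi> where "\<Phi> = (\<lambda>m. \<lambda>p\<in>?P. \<rho> p m)"
  show thesis
  proof
    have "\<Phi> ` carrier M \<subseteq> (\<Pi>\<^sub>E p\<in>?P. carrier (F p))"
    proof (rule image_subsetI)
      fix m assume m: "m \<in> carrier M"
      show "\<Phi> m \<in> (\<Pi>\<^sub>E p\<in>?P. carrier (F p))"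
        unfolding \<Phi>_def by (intro restrict_PiE_iff[THEN iffD2] ballI hom_in_carrier[OF hom] m)
    qed
    moreover have "finite (\<Pi>\<^sub>E p\<in>?P. carrier (F p))"
      using assms(2) fin by (intro finite_PiE) auto
    ultimately show "finite (\<Phi> ` carrier M)"
      by (rule finite_subset)
    show "inj_on \<Phi> \<Omega>"
    proof (rule inj_onI, rule ccontr)
      fix m n assume mn: "m \<in> \<Omega>" "n \<in> \<Omega>" "\<Phi> m = \<Phi> n" "m \<noteq> n"
      then have P: "(m, n) \<in> ?P"
        by auto
      then show False
        using sep[OF P] fun_cong[OF mn(3), of "(m, n)"] by (simp add: \<Phi>_def)
    qed
  next
    fix m\<^sub>1 m\<^sub>2 m
    assume m: "m\<^sub>1 \<in> carrier M" "m\<^sub>2 \<in> carrier M" "m \<in> carrier M" and eq: "\<Phi> m\<^sub>1 = \<Phi> m\<^sub>2"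
    have "\<rho> p (m \<otimes>\<^bsub>M\<^esub> m\<^sub>1) = \<rho> p (m \<otimes>\<^bsub>M\<^esub> m\<^sub>2)" if p: "p \<in> ?P" for p
    proof -
      have "\<rho> p m\<^sub>1 = \<rho> p m\<^sub>2"
        using fun_cong[OF eq, of p] p by (simp add: \<Phi>_def)
      then show ?thesis
        using m by (simp add: hom_mult[OF hom[OF p]])
    qed
    then show "\<Phi> (m \<otimes>\<^bsub>M\<^esub> m\<^sub>1) = \<Phi> (m \<otimes>\<^bsub>M\<^esub> m\<^sub>2)"
      unfolding \<Phi>_def by (rule restrict_ext)
  qed
qed

lemma finite_image_if_factors:
  assumes fin: "finite (f ` X)"
    and factors: "\<And>x y. x \<in> X \<Longrightarrow> y \<in> X \<Longrightarrow> f x = f y \<Longrightarrow> g x = g y"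
  shows "finite (g ` X)"
proof (rule finite_surj[OF fin])
  have "g x = g (inv_into X f (f x))" if "x \<in> X" for x
    using that by (intro factors) (auto simp: inv_into_into f_inv_into_f)
  then show "g ` X \<subseteq> (g \<circ> inv_into X f) ` f ` X"
    by (auto simp: image_iff)
qed

text \<open>
  A pattern on a finite set \<open>\<Omega>\<close> is extended to all of \<open>M\<close> through a map \<open>\<Phi>\<close> with finite image that
  separates \<open>\<Omega>\<close>. Left compatibility of \<open>\<Phi>\<close> makes each translate depend only on a value of \<open>\<Phi>\<close>.
\<close>

lemma (in monoid) periodic_extension:
  assumes "residually_finite G" and x: "x \<in> configurations G A"
    and "finite \<Omega>" and \<Omega>: "\<Omega> \<subseteq> carrier G"
  obtains y where "y \<in> periodic G A" and "\<And>m. m \<in> \<Omega> \<Longrightarrow> y m = x m"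
proof -
  obtain \<Phi> :: "'a \<Rightarrow> 'a \<times> 'a \<Rightarrow> nat" where fin: "finite (\<Phi> ` carrier G)" and inj: "inj_on \<Phi> \<Omega>"
    and left: "\<And>m\<^sub>1 m\<^sub>2 m. m\<^sub>1 \<in> carrier G \<Longrightarrow> m\<^sub>2 \<in> carrier G \<Longrightarrow> m \<in> carrier G \<Longrightarrow>
      \<Phi> m\<^sub>1 = \<Phi> m\<^sub>2 \<Longrightarrow> \<Phi> (m \<otimes> m\<^sub>1) = \<Phi> (m \<otimes> m\<^sub>2)"
    using residually_finite_separates_finite[OF assms(1,3,4)] by blast
  \<comment> \<open>The value at the identity serves as an element of \<open>A\<close> for the classes that miss \<open>\<Omega>\<close>.\<close>
  define g where "g = (\<lambda>v. x (if v \<in> \<Phi> ` \<Omega> then inv_into \<Omega> \<Phi> v else \<one>))"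
  define y where "y = (\<lambda>m\<in>carrier G. g (\<Phi> m))"
  show thesis
  proof
    have "(if v \<in> \<Phi> ` \<Omega> then inv_into \<Omega> \<Phi> v else \<one>) \<in> carrier G" for v
      using \<Omega> inv_into_into[of v \<Phi> \<Omega>] by auto
    then have "y \<in> configurations G A"
      using x unfolding configurations_def y_def g_def restrict_PiE_iff by (blast intro: PiE_mem)
    moreover have "finite ((\<lambda>m. shift G m y) ` carrier G)"
    proof (rule finite_image_if_factors[OF fin])
      fix m\<^sub>1 m\<^sub>2 assume m: "m\<^sub>1 \<in> carrier G" "m\<^sub>2 \<in> carrier G" "\<Phi> m\<^sub>1 = \<Phi> m\<^sub>2"
      show "shift G m\<^sub>1 y = shift G m\<^sub>2 y"
        unfolding shift_def
      proof (rule restrict_ext)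
        fix m assume "m \<in> carrier G"
        then show "y (m \<otimes> m\<^sub>1) = y (m \<otimes> m\<^sub>2)"
          using m left[of m\<^sub>1 m\<^sub>2 m] by (simp add: y_def)
      qed
    qed
    ultimately show "y \<in> periodic G A"
      by (simp add: periodic_def)
  next
    fix m assume "m \<in> \<Omega>"
    then show "y m = x m"
      using \<Omega> inj by (auto simp: y_def g_def)
  qed
qed

lemma (in monoid) periodic_dense:
  assumes "residually_finite G"
  shows "(prodiscrete G A) closure_of (periodic G A) = configurations G A"
proof
  show "(prodiscrete G A) closure_of (periodic G A) \<subseteq> configurations G A"
    by (metis closure_of_subset_topspace topspace_prodiscrete)
  show "configurations G A \<subseteq> (prodiscrete G A) closure_of (periodic G A)"
  proof
    fix x assume x: "x \<in> configurations G A"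
    have "\<exists>y\<in>periodic G A. y \<in> V" if V: "x \<in> V" "openin (prodiscrete G A) V" for V
    proof -
      obtain U where finU: "finite {i \<in> carrier G. U i \<noteq> A}"
        and xU: "x \<in> Pi\<^sub>E (carrier G) U" and UV: "Pi\<^sub>E (carrier G) U \<subseteq> V"
        using V(2)[unfolded prodiscrete_def openin_product_topology_alt, THEN bspec, OF V(1)]
        by auto
      obtain y where y: "y \<in> periodic G A" "\<And>m. m \<in> {i \<in> carrier G. U i \<noteq> A} \<Longrightarrow> y m = x m"
        using periodic_extension[OF assms x finU] by blast
      have "y \<in> carrier G \<rightarrow>\<^sub>E A"
        using y(1) by (simp add: periodic_def configurations_def)
      moreover from this have "y m \<in> U m" if "m \<in> carrier G" for m
        using that y(2)[of m] PiE_mem[OF xU that] by (cases "U m = A") auto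
      ultimately have "y \<in> Pi\<^sub>E (carrier G) U"
        by (simp add: PiE_iff)
      then show ?thesis
        using y(1) UV by blast
    qed
    then show "x \<in> (prodiscrete G A) closure_of (periodic G A)"
      using x by (auto simp: in_closure_of topspace_prodiscrete)
  qed
qed

lemma (in monoid) cellular_automata_eq_if_eq_on_periodic:
  assumes "residually_finite G"
    and \<sigma>: "\<sigma> \<in> cellular_automata G A" and \<tau>: "\<tau> \<in> cellular_automata G A"
    and eq: "\<And>x. x \<in> periodic G A \<Longrightarrow> \<sigma> x = \<tau> x"
  shows "\<sigma> = \<tau>"
proof (rule PiE_ext[where k = "configurations G A" and s = "\<lambda>_. configurations G A"])
  fix x assume "x \<in> configurations G A"
  then have "x \<in> (prodiscrete G A) closure_of (periodic G A)"
    by (simp add: periodic_dense assms(1))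
  moreover have "Hausdorff_space (prodiscrete G A)"
    by (simp add: prodiscrete_def Hausdorff_space_product_topology)
  ultimately show "\<sigma> x = \<tau> x"
    by (rule forall_in_closure_of_eq[where f = \<sigma> and g = \<tau>]) (use \<sigma> \<tau> eq in \<open>auto simp: cellular_automata_def\<close>)
qed (use \<sigma> \<tau> in \<open>auto simp: cellular_automata_def\<close>)

section \<open>Residual finiteness of the monoid of cellular automata\<close>

definition at_least_as_periodic ::
    "('m, 'b) monoid_scheme \<Rightarrow> 'a set \<Rightarrow> ('m \<Rightarrow> 'a) \<Rightarrow> ('m \<Rightarrow> 'a) set" where
  "at_least_as_periodic M A x =
     {y \<in> configurations M A. \<forall>m\<^sub>1\<in>carrier M. \<forall>m\<^sub>2\<in>carrier M.
        shift M m\<^sub>1 x = shift M m\<^sub>2 x \<longrightarrow> shift M m\<^sub>1 y = shift M m\<^sub>2 y}"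

text \<open>
  Evaluating \<open>my\<close> at the identity recovers \<open>y m\<close>, so \<open>y\<close> factors through the orbit map of \<open>x\<close>.
\<close>

lemma (in monoid) finite_at_least_as_periodic:
  assumes "finite A" and x: "x \<in> periodic G A"
  shows "finite (at_least_as_periodic G A x)"
proof (rule finite_surj)
  let ?s = "\<lambda>m. shift G m x"
  let ?lift = "\<lambda>k. \<lambda>m\<in>carrier G. k (?s m)"
  show "finite (?s ` carrier G \<rightarrow>\<^sub>E A)"
    using assms by (intro finite_PiE) (auto simp: periodic_def)
  show "at_least_as_periodic G A x \<subseteq> ?lift ` (?s ` carrier G \<rightarrow>\<^sub>E A)"
  proof
    fix y assume y: "y \<in> at_least_as_periodic G A x"
    then have conf: "y \<in> carrier G \<rightarrow>\<^sub>E A"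
      by (simp add: at_least_as_periodic_def configurations_def)
    have at_one: "y m = shift G m y \<one>" if "m \<in> carrier G" for m
      using that by (simp add: shift_def)
    define k where "k = (\<lambda>z\<in>?s ` carrier G. y (inv_into (carrier G) ?s z))"
    have "k \<in> ?s ` carrier G \<rightarrow>\<^sub>E A"
      unfolding k_def restrict_PiE_iff using conf by (blast intro: inv_into_into)
    moreover have "y = ?lift k"
    proof (rule extensionalityI[of _ "carrier G"])
      fix m assume m: "m \<in> carrier G"
      let ?n = "inv_into (carrier G) ?s (?s m)"
      have n: "?n \<in> carrier G" "?s ?n = ?s m"
        using m by (auto simp: inv_into_into f_inv_into_f[where f = ?s])
      then have "shift G ?n y = shift G m y"
        using y m unfolding at_least_as_periodic_def by blast
      then show "y m = ?lift k m"
        using m n(1) by (simp add: k_def at_one)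
    qed (use conf in \<open>auto simp: PiE_def\<close>)
    ultimately show "y \<in> ?lift ` (?s ` carrier G \<rightarrow>\<^sub>E A)"
      by blast
  qed
qed

lemma cellular_automaton_preserves_at_least_as_periodic:
  assumes "\<tau> \<in> cellular_automata M A" and "y \<in> at_least_as_periodic M A x"
  shows "\<tau> y \<in> at_least_as_periodic M A x"
proof -
  have conf: "y \<in> configurations M A"
    using assms(2) by (simp add: at_least_as_periodic_def)
  then have equivariant: "shift M m (\<tau> y) = \<tau> (shift M m y)" if "m \<in> carrier M" for m
    using assms(1) that by (simp add: cellular_automata_def)
  have "\<tau> y \<in> configurations M A"
    using assms(1) conf by (auto simp: cellular_automata_def)
  moreover have "shift M m\<^sub>1 (\<tau> y) = shift M m\<^sub>2 (\<tau> y)"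
    if m: "m\<^sub>1 \<in> carrier M" "m\<^sub>2 \<in> carrier M" "shift M m\<^sub>1 x = shift M m\<^sub>2 x" for m\<^sub>1 m\<^sub>2
  proof -
    have "shift M m\<^sub>1 y = shift M m\<^sub>2 y"
      using assms(2) m unfolding at_least_as_periodic_def by blast
    then show ?thesis
      using m(1,2) by (simp only: equivariant)
  qed
  ultimately show ?thesis
    unfolding at_least_as_periodic_def by blast
qed

lemma (in monoid) CA_residually_finite:
  fixes \<sigma> \<tau> :: "('a \<Rightarrow> 'c) \<Rightarrow> 'a \<Rightarrow> 'c"
  assumes "residually_finite G" and "finite A"
    and \<sigma>: "\<sigma> \<in> carrier (CA G A)" and \<tau>: "\<tau> \<in> carrier (CA G A)" and "\<sigma> \<noteq> \<tau>"
  obtains F :: "(('a \<Rightarrow> 'c) \<Rightarrow> 'a \<Rightarrow> 'c) monoid" and \<phi>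
  where "finite (carrier F)" and "\<phi> \<in> hom (CA G A) F" and "\<phi> \<sigma> \<noteq> \<phi> \<tau>"
proof -
  obtain x where x: "x \<in> periodic G A" and ne: "\<sigma> x \<noteq> \<tau> x"
    using cellular_automata_eq_if_eq_on_periodic[OF assms(1), of \<sigma> A \<tau>] \<sigma> \<tau> \<open>\<sigma> \<noteq> \<tau>\<close>
    by (auto simp: CA_def)
  let ?I = "at_least_as_periodic G A x"
  let ?F = "\<lparr>carrier = ?I \<rightarrow>\<^sub>E ?I, mult = compose ?I, one = \<lambda>y\<in>?I. y\<rparr>"
  show thesis
  proof
    show "finite (carrier ?F)"
      using finite_at_least_as_periodic[OF assms(2) x] by (auto intro: finite_PiE)
    have conf: "?I \<subseteq> configurations G A"
      by (auto simp: at_least_as_periodic_def)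
    have maps: "\<rho> y \<in> ?I" if "\<rho> \<in> carrier (CA G A)" "y \<in> ?I" for \<rho> y
      using that by (simp add: CA_def cellular_automaton_preserves_at_least_as_periodic)
    show "(\<lambda>\<rho>. restrict \<rho> ?I) \<in> hom (CA G A) ?F"
    proof (rule homI)
      fix \<rho> assume "\<rho> \<in> carrier (CA G A)"
      then show "restrict \<rho> ?I \<in> carrier ?F"
        by (simp add: maps)
    next
      fix \<rho>\<^sub>1 \<rho>\<^sub>2 assume "\<rho>\<^sub>1 \<in> carrier (CA G A)" "\<rho>\<^sub>2 \<in> carrier (CA G A)"
      then show "restrict (\<rho>\<^sub>1 \<otimes>\<^bsub>CA G A\<^esub> \<rho>\<^sub>2) ?I = restrict \<rho>\<^sub>1 ?I \<otimes>\<^bsub>?F\<^esub> restrict \<rho>\<^sub>2 ?I"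
        using conf by (auto simp: CA_def compose_def fun_eq_iff restrict_def maps)
    qed
    have "x \<in> ?I"
      using x by (simp add: at_least_as_periodic_def periodic_def)
    show "restrict \<sigma> ?I \<noteq> restrict \<tau> ?I"
    proof
      assume "restrict \<sigma> ?I = restrict \<tau> ?I"
      from fun_cong[OF this, of x] show False
        using ne \<open>x \<in> ?I\<close> by simp
    qed
  qed
qed

section \<open>The Hopf property\<close>

theorem corollary1p3:
  fixes M :: "('m, 'b) monoid_scheme" and A :: "'a set" and T :: "(('m \<Rightarrow> 'a) \<Rightarrow> 'm \<Rightarrow> 'a) set"
  assumes "monoid M" and "residually_finite M" and "finite A"
    and "fin_gen_subsemigroup T (CA M A)"
  shows "Hopfian ((CA M A)\<lparr>carrier := T\<rparr>)"
proof -
  interpret monoid M by fact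
  interpret CA: monoid "CA M A" by (rule monoid_CA)
  let ?S = "(CA M A)\<lparr>carrier := T\<rparr>"
  obtain B where T: "subsemigroup T (CA M A)"
    and B: "finite B" "semigroup_generate (CA M A) B = T"
    using assms(4) unfolding fin_gen_subsemigroup_def by blast
  have sub: "T \<subseteq> carrier (CA M A)"
    using T by (simp add: subsemigroup_def)
  have "semigroup_struct ?S"
    using T sub by (auto simp: semigroup_struct_def subsemigroup_def CA.m_assoc subset_iff)
  moreover have "semigroup_generate ?S B = carrier ?S"
    using B(2) by simp
  moreover have "\<exists>F :: (('m \<Rightarrow> 'a) \<Rightarrow> 'm \<Rightarrow> 'a) monoid.
      finite (carrier F) \<and> (\<exists>\<phi>\<in>hom ?S F. \<phi> \<sigma> \<noteq> \<phi> \<tau>)"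
    if \<sigma>\<tau>: "\<sigma> \<in> carrier ?S" "\<tau> \<in> carrier ?S" "\<sigma> \<noteq> \<tau>" for \<sigma> \<tau>
  proof -
    have "\<sigma> \<in> carrier (CA M A)" "\<tau> \<in> carrier (CA M A)"
      using \<sigma>\<tau> sub by auto
    then obtain F :: "(('m \<Rightarrow> 'a) \<Rightarrow> 'm \<Rightarrow> 'a) monoid" and \<phi>
      where F: "finite (carrier F)" "\<phi> \<in> hom (CA M A) F" "\<phi> \<sigma> \<noteq> \<phi> \<tau>"
      using CA_residually_finite[OF assms(2,3) _ _ \<sigma>\<tau>(3)] by blast
    have "\<phi> \<in> hom ?S F"
      using F(2) sub by (auto simp: hom_def Pi_iff subset_iff)
    then show ?thesis
      using F by blast
  qed
  ultimately show ?thesis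
    by (rule Hopfian_if_residually_finite[OF _ B(1)])
qed

end
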